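(* For a nonnegative integer $n$, let (i) $D_1(n)$ be the number of partitions of $n$ into parts congruent to $1,16,18,34,50,52$ or $67 \pmod{68}$, where parts congruent to $1$ or $67 \pmod{68}$ come in $2$ colors, parts congruent to $34 \pmod{68}$ come in $4$ colors, and the other parts have $1$ color; (ii) $D_2(n)$ be the number of partitions of $n$ into parts congruent to $16,18,33,34,35,50$ or $52 \pmod{68}$, where parts congruent to $33$ or $35 \pmod{68}$ come in $2$ colors, parts congruent to $34 \pmod{68}$ come in $4$ colors, and the other parts have $1$ color; (iii) $D_3(n)$ be the number of partitions of $n$ into parts congruent to $1,17,33,35,51$ or $67 \pmod{68}$, each part coming in $2$ colors. (Here $D_1(0)=D_2(0)=D_3(0)=1$.) Then for every integer $n\ge 16$, \[ D_1(n)-D_2(n-16)-D_3(n)=0. \]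
   Context: A partition of $n$ in which a part size class "comes in $r$ colors" means each part of that class is labeled with one of $r$ distinct colors, partitions being counted as multisets of colored parts. Equivalently $\sum_n D_1(n)q^n=1/\big((q^{16},q^{18},q^{50},q^{52};q^{68})_\infty (q,q^{67};q^{68})_\infty^2 (q^{34};q^{68})_\infty^4\big)$, $\sum_n D_2(n)q^n=1/\big((q^{16},q^{18},q^{50},q^{52};q^{68})_\infty (q^{33},q^{35};q^{68})_\infty^2 (q^{34};q^{68})_\infty^4\big)$, $\sum_n D_3(n)q^n=1/(q,q^{17},q^{33},q^{35},q^{51},q^{67};q^{68})_\infty^2$, where $(\lambda;q)_\infty=\prod_{n\ge0}(1-\lambda q^n)$. *)

theory Defs
  imports Main "HOL-Library.Multiset"
begin

(* A coloured part is a pair (m, c): m is its size and c its colour.  The function r gives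
   the number of colours available for each size, and r m = 0 means that m is not allowed
   as a part. *)
definition colored_partitions :: "(nat \<Rightarrow> nat) \<Rightarrow> nat \<Rightarrow> (nat \<times> nat) multiset set" where
  "colored_partitions r n =
     {M. (\<forall>(m, c) \<in># M. 0 < m \<and> c < r m) \<and> (\<Sum>p\<in>#M. fst p) = n}"

(* card yields 0 on infinite sets; this does not occur in the counts below. *)
lemma finite_colored_partitions: "finite (colored_partitions r n)"
proof -
  let ?A = "SIGMA m:{1..n}. {..<r m}"
  have "colored_partitions r n \<subseteq> mset ` {xs. set xs \<subseteq> ?A \<and> length xs \<le> n}"
  proof
    fix M assume M: "M \<in> colored_partitions r n"
    have ok: "0 < m \<and> c < r m" if "(m, c) \<in># M" for m c
      using M that unfolding colored_partitions_def by blast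
    have tot: "(\<Sum>p\<in>#M. fst p) = n"
      using M by (simp add: colored_partitions_def)
    have le: "fst p \<le> n" if "p \<in># M" for p
    proof -
      obtain M' where "M = add_mset p M'"
        using multi_member_split[OF \<open>p \<in># M\<close>] by blast
      then show ?thesis using tot by simp
    qed
    have "(\<Sum>p\<in>#M. 1) \<le> (\<Sum>p\<in>#M. fst p)"
    proof (rule sum_mset_mono)
      fix p assume "p \<in># M"
      then show "1 \<le> fst p" using ok[of "fst p" "snd p"] by simp
    qed
    then have sz: "size M \<le> n"
      using tot by simp
    obtain xs where xs: "M = mset xs" by (metis ex_mset)
    have "set xs \<subseteq> ?A"
    proof
      fix p assume "p \<in> set xs"
      then have "p \<in># M" using xs by simp
      then show "p \<in> ?A"
        using ok[of "fst p" "snd p"] le[of p] by (cases p) simp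
    qed
    moreover have "length xs \<le> n" using sz xs by simp
    ultimately show "M \<in> mset ` {xs. set xs \<subseteq> ?A \<and> length xs \<le> n}"
      using xs by blast
  qed
  moreover have "finite {xs. set xs \<subseteq> ?A \<and> length xs \<le> n}"
    by (rule finite_lists_length_le) simp
  ultimately show ?thesis
    by (meson finite_imageI finite_subset)
qed

definition D1 :: "nat \<Rightarrow> nat" where
  "D1 n = card (colored_partitions
     (\<lambda>m. if m mod 68 \<in> {1, 67} then 2
          else if m mod 68 = 34 then 4
          else if m mod 68 \<in> {16, 18, 50, 52} then 1
          else 0) n)"

definition D2 :: "nat \<Rightarrow> nat" where
  "D2 n = card (colored_partitions
     (\<lambda>m. if m mod 68 \<in> {33, 35} then 2
          else if m mod 68 = 34 then 4
          else if m mod 68 \<in> {16, 18, 50, 52} then 1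
          else 0) n)"

definition D3 :: "nat \<Rightarrow> nat" where
  "D3 n = card (colored_partitions
     (\<lambda>m. if m mod 68 \<in> {1, 17, 33, 35, 51, 67} then 2 else 0) n)"

end

theory Submission
  imports Defs "HOL-Analysis.Infinite_Products" "HOL-Analysis.Infinite_Sum"
begin

text \<open>
  Write \<open>J a\<close> for the product of \<open>(1 - x ^ m)\<close> over all \<open>m > 0\<close> congruent to \<open>a\<close> or \<open>- a\<close> modulo 68,
  with multiplicity two for \<open>a = 34\<close>. Clearing denominators, the claim on the generating functions becomes
  \<open>(J 33)\<^sup>2 (J 17)\<^sup>2 - x ^ 16 (J 1)\<^sup>2 (J 17)\<^sup>2 = J 16 J 18 (J 34)\<^sup>2\<close>, which is Weierstrass' three-term
  relation for theta functions of nome \<open>x ^ 68\<close> at the points \<open>x ^ 25, x ^ 26, x ^ 8, x ^ 9\<close>.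
  By the Jacobi triple product the theta products may be replaced by theta series; a product
  \<open>\<theta>(x z) \<theta>(x / z)\<close> of two series is, up to a factor, a two by two determinant, so that the three-term
  relation is a Pluecker relation.
\<close>

section \<open>Theta series\<close>

text \<open>Fubini: absolute summability of the product family allows summation row by row. It
  permits the later rearrangement of a product of two theta series along even and odd
  diagonals.\<close>

lemma has_sum_times:
  fixes f :: "'a \<Rightarrow> real" and g :: "'b \<Rightarrow> real"
  assumes f: "f abs_summable_on A" and g: "g abs_summable_on B"
  shows "((\<lambda>(x, y). f x * g y) has_sum (infsum f A * infsum g B)) (A \<times> B)"
proof -
  have "(\<lambda>(x, y). f x * g y) abs_summable_on (A \<times> B)"
    unfolding abs_summable_on_Sigma_iff
    using f g by (auto simp: abs_mult infsum_cmult_right' intro!: summable_on_cmult_right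
        summable_on_cmult_left abs_summable_on_comparison_test'[OF summable_on_cmult_left[OF f]])
  then have summable: "(\<lambda>(x, y). f x * g y) summable_on (A \<times> B)"
    by (rule abs_summable_summable)
  show ?thesis
  proof (rule has_sum_SigmaI)
    show "((\<lambda>y. (case (x, y) of (x, y) \<Rightarrow> f x * g y)) has_sum (f x * infsum g B)) B" for x
      using has_sum_cmult_right[OF has_sum_infsum[OF abs_summable_summable[OF g]]] by simp
    show "((\<lambda>x. f x * infsum g B) has_sum (infsum f A * infsum g B)) A"
      by (intro has_sum_cmult_left has_sum_infsum abs_summable_summable[OF f])
  qed (rule summable)
qed

text \<open>The two-sided theta series. Since \<open>j * (j - 1)\<close> is even, the division is
  exact. No sign is built in, so the products with zeros at the powers of \<open>q\<close> belong to
  the argument \<open>- z\<close>.\<close>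

definition jtheta :: "real \<Rightarrow> real \<Rightarrow> real" where
  "jtheta q z = (\<Sum>\<^sub>\<infinity>j::int. q powi (j * (j - 1) div 2) * z powi j)"

text \<open>Consecutive terms have ratio \<open>q ^ n * c\<close>, which tends to 0 whatever the
  size of \<open>c\<close>.\<close>

lemma summable_theta_nat:
  fixes q c :: real
  assumes q: "0 < q" "q < 1"
  shows "summable (\<lambda>n. norm (q ^ (n * (n - 1) div 2) * c ^ n))"
proof -
  have "(\<lambda>n. q ^ n * \<bar>c\<bar>) \<longlonglongrightarrow> 0 * \<bar>c\<bar>"
    using q by (intro tendsto_intros) auto
  then have "eventually (\<lambda>n. q ^ n * \<bar>c\<bar> < 1/2) sequentially"
    by (intro order_tendstoD) auto
  then obtain N where N: "\<And>n. n \<ge> N \<Longrightarrow> q ^ n * \<bar>c\<bar> < 1/2"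
    by (auto simp: eventually_sequentially)
  show ?thesis
  proof (rule summable_ratio_test)
    fix n assume "n \<ge> N"
    have "Suc n * (Suc n - 1) div 2 = n + n * (n - 1) div 2"
      by (cases n) auto
    then have "norm (norm (q ^ (Suc n * (Suc n - 1) div 2) * c ^ Suc n))
        = (q ^ n * \<bar>c\<bar>) * norm (norm (q ^ (n * (n - 1) div 2) * c ^ n))"
      using q by (simp only: power_add) (simp add: abs_mult mult_ac)
    also have "\<dots> \<le> 1/2 * norm (norm (q ^ (n * (n - 1) div 2) * c ^ n))"
      using N[OF \<open>n \<ge> N\<close>] by (intro mult_right_mono) auto
    finally show "norm (norm (q ^ (Suc n * (Suc n - 1) div 2) * c ^ Suc n))
        \<le> 1/2 * norm (norm (q ^ (n * (n - 1) div 2) * c ^ n))" .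
  qed simp
qed

lemma summable_theta_nonneg:
  fixes q z :: real
  assumes q: "0 < q" "q < 1"
  shows "(\<lambda>j::int. q powi (j * (j - 1) div 2) * z powi j) abs_summable_on {0..}"
proof -
  have "(\<lambda>n. norm (q ^ (n * (n - 1) div 2) * z ^ n)) summable_on (UNIV :: nat set)"
    using summable_theta_nat[OF q, of z] by (intro norm_summable_imp_summable_on) simp
  also have "?this \<longleftrightarrow> ?thesis"
  proof (rule summable_on_reindex_bij_witness[of _ nat int])
    fix n :: nat
    have "int n * (int n - 1) div 2 = int (n * (n - 1) div 2)"
      by (cases n) (auto simp: zdiv_int algebra_simps)
    then show "norm (q powi (int n * (int n - 1) div 2) * z powi int n) =
        norm (q ^ (n * (n - 1) div 2) * z ^ n)"
      by (simp only: power_int_of_nat)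
  qed auto
  finally show ?thesis .
qed

text \<open>The reflection of \<open>j\<close> to \<open>1 - j\<close> fixes
  \<open>j * (j - 1)\<close> and replaces \<open>z\<close> by \<open>1 / z\<close> up to a factor
  \<open>z\<close>, so the negative half is a tail of the nonnegative half at
  \<open>1 / z\<close>.\<close>

lemma summable_theta:
  fixes q z :: real
  assumes q: "0 < q" "q < 1" and z: "z \<noteq> 0"
  shows "(\<lambda>j::int. q powi (j * (j - 1) div 2) * z powi j) abs_summable_on UNIV"
proof -
  let ?f = "\<lambda>z (j::int). norm (q powi (j * (j - 1) div 2) * z powi j)"
  have "?f (1 / z) summable_on {2..}"
    by (rule summable_on_subset_banach[OF summable_theta_nonneg[OF q]]) auto
  then have "(\<lambda>j. \<bar>z\<bar> * ?f (1 / z) j) summable_on {2..}"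
    by (rule summable_on_cmult_right)
  also have "?this \<longleftrightarrow> ?f z summable_on {..<0}"
  proof (rule summable_on_reindex_bij_witness[of _ "\<lambda>j. 1 - j" "\<lambda>j. 1 - j"])
    fix j :: int
    have "(1 - j) * (1 - j - 1) = j * (j - 1)"
      by (simp add: algebra_simps)
    moreover have "z powi (1 - j) = z * (1 / z) powi j"
      using z by (simp add: power_int_diff power_int_divide_distrib)
    ultimately show "?f z (1 - j) = \<bar>z\<bar> * ?f (1 / z) j"
      by (simp add: abs_mult mult_ac)
  qed auto
  finally have "?f z summable_on ({..<0} \<union> {0..})"
    using summable_theta_nonneg[OF q, of z] by (intro summable_on_Un_disjoint) auto
  also have "{..<0} \<union> {0..} = (UNIV :: int set)"
    by auto
  finally show ?thesis .
qed

text \<open>Quasi-periodicity: moving the index by one changes the triangular exponent by exactly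
  \<open>j\<close>.\<close>

lemma jtheta_shift:
  assumes "q \<noteq> 0" "z \<noteq> 0"
  shows "jtheta q (q * z) = jtheta q z / z"
proof -
  have "(\<Sum>\<^sub>\<infinity>j::int. q powi (j * (j - 1) div 2) * (q * z) powi j)
      = (\<Sum>\<^sub>\<infinity>j::int. 1 / z * (q powi (j * (j - 1) div 2) * z powi j))"
  proof (rule infsum_reindex_bij_witness[of _ "\<lambda>j. j - 1" "\<lambda>j. j + 1"])
    fix j :: int
    have "(j + 1) * (j + 1 - 1) = j * (j - 1) + j * 2"
      by (simp add: algebra_simps)
    then have "(j + 1) * (j + 1 - 1) div 2 = j * (j - 1) div 2 + j"
      by simp
    then show "1 / z * (q powi ((j + 1) * (j + 1 - 1) div 2) * z powi (j + 1))
        = q powi (j * (j - 1) div 2) * (q * z) powi j"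
      using assms by (simp only: power_int_mult_distrib) (simp add: power_int_add)
  qed auto
  then show ?thesis
    by (simp only: jtheta_def infsum_cmult_right') simp
qed

section \<open>Products of two theta series and Weierstrass' relation\<close>

lemma twice_half_pred: "2 * (k * (k - 1) div 2) = k * (k - 1)" for k :: int
  by simp

lemma powi_square_half:
  fixes q :: real
  shows "(q\<^sup>2) powi (k * (k - 1) div 2) = q powi (k * (k - 1))"
  by (metis twice_half_pred power_int_mult power_int_numeral)

text \<open>The exponents of \<open>q\<close> in the product of the two series split after the substitution
  \<open>s = m + n\<close>, \<open>d = m - n\<close>; the two summands on the right come from even and odd \<open>s\<close>.\<close>
lemma jtheta_product:
  assumes q: "0 < q" "q < 1" and x: "x \<noteq> 0" and z: "z \<noteq> 0"
  shows "jtheta q (- (x * z)) * jtheta q (- (x / z))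
    = jtheta (q\<^sup>2) (x\<^sup>2) * jtheta (q\<^sup>2) (q * z\<^sup>2)
      - x / z * jtheta (q\<^sup>2) (q * x\<^sup>2) * jtheta (q\<^sup>2) (z\<^sup>2)"
proof -
  define g where "g = (\<lambda>(q::real) (z::real) (j::int). q powi (j * (j - 1) div 2) * z powi j)"
  have J: "jtheta q z = infsum (g q z) UNIV" for q z
    by (simp add: jtheta_def g_def)
  have summable: "g q z abs_summable_on UNIV" if "0 < q" "q < 1" "z \<noteq> 0" for q z
    using summable_theta[OF that] by (simp add: g_def)
  have q2: "0 < q\<^sup>2" "q\<^sup>2 < 1"
    using q by (auto simp: power_less_one_iff)
  define h where "h = (\<lambda>(m, n). g q (- (x * z)) m * g q (- (x / z)) n)"
  have h: "h (m, n) = (-1) powi (m + n) * q powi (m * (m - 1) div 2 + n * (n - 1) div 2)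
      * x powi (m + n) * z powi (m - n)" for m n
  proof -
    have "- (x * z) = (-1) * x * z" "- (x / z) = (-1) * x * (1 / z)"
      by auto
    then show ?thesis
      unfolding h_def g_def using q x z
      by (simp only: prod.case power_int_mult_distrib power_int_add power_int_diff power_int_divide_distrib power_int_1_left)
        (simp add: power_int_add power_int_diff)
  qed
  have total: "(h has_sum (jtheta q (- (x * z)) * jtheta q (- (x / z)))) UNIV"
    using has_sum_times[OF summable summable, of q "- (x * z)" q "- (x / z)"] q x z
    by (simp add: h_def J)
  have ev: "(h has_sum (jtheta (q\<^sup>2) (x\<^sup>2) * jtheta (q\<^sup>2) (q * z\<^sup>2))) {(m, n). even (m + n)}"
  proof -
    have "((\<lambda>(k, l). g (q\<^sup>2) (x\<^sup>2) k * g (q\<^sup>2) (q * z\<^sup>2) l) has_sum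
        (jtheta (q\<^sup>2) (x\<^sup>2) * jtheta (q\<^sup>2) (q * z\<^sup>2))) (UNIV \<times> UNIV)"
      unfolding J by (intro has_sum_times summable q2) (use q x z in auto)
    also have "?this \<longleftrightarrow> ?thesis"
    proof (rule has_sum_reindex_bij_witness[of _
          "\<lambda>(m, n). ((m + n) div 2, (m - n) div 2)" "\<lambda>(k, l). (k + l, k - l)"])
      fix p :: "int \<times> int"
      obtain k l where p: "p = (k, l)" by (cases p)
      have "(k + l) * (k + l - 1) + (k - l) * (k - l - 1) = 2 * (k * (k - 1) + l * l)"
        by (simp add: algebra_simps)
      moreover note twice_half_pred[of "k + l"] twice_half_pred[of "k - l"]
      ultimately have e: "(k + l) * (k + l - 1) div 2 + (k - l) * (k - l - 1) div 2
          = k * (k - 1) + l * (l - 1) + l"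
        by (simp add: algebra_simps)
      have [simp]: "(-1) powi (2 * k) = (1::real)" "x powi (2 * k) = (x\<^sup>2) powi k"
        "z powi (2 * l) = (z\<^sup>2) powi l"
        by (simp_all add: power_int_mult)
      have "k + l + (k - l) = 2 * k" "k + l - (k - l) = 2 * l"
        by auto
      then have "h (k + l, k - l) = q powi (k * (k - 1) + l * (l - 1) + l) * (x\<^sup>2) powi k * (z\<^sup>2) powi l"
        unfolding h e by simp
      also have "\<dots> = g (q\<^sup>2) (x\<^sup>2) k * g (q\<^sup>2) (q * z\<^sup>2) l"
        using q by (simp add: g_def powi_square_half power_int_mult_distrib power_int_add)
      finally show "h (case p of (k, l) \<Rightarrow> (k + l, k - l))
          = (case p of (k, l) \<Rightarrow> g (q\<^sup>2) (x\<^sup>2) k * g (q\<^sup>2) (q * z\<^sup>2) l)"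
        by (simp add: p)
    qed ((auto; presburger)+)
    finally show ?thesis .
  qed
  have od: "(h has_sum (- (x / z) * jtheta (q\<^sup>2) (q * x\<^sup>2) * jtheta (q\<^sup>2) (z\<^sup>2))) {(m, n). odd (m + n)}"
  proof -
    \<comment> \<open>The odd terms naturally yield the series at
      \<open>q\<^sup>2 * z\<^sup>2\<close> with prefactor \<open>x * z\<close>; quasi-periodicity
      returns it to \<open>z\<^sup>2\<close> with prefactor \<open>x / z\<close>.\<close>
    have "jtheta (q\<^sup>2) (q\<^sup>2 * z\<^sup>2) = jtheta (q\<^sup>2) (z\<^sup>2) / z\<^sup>2"
      using q z by (intro jtheta_shift) auto
    then have s: "- (x / z) * jtheta (q\<^sup>2) (q * x\<^sup>2) * jtheta (q\<^sup>2) (z\<^sup>2)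
        = - (x * z) * (jtheta (q\<^sup>2) (q * x\<^sup>2) * jtheta (q\<^sup>2) (q\<^sup>2 * z\<^sup>2))"
      using z by (simp add: power2_eq_square)
    have "((\<lambda>(k, l). g (q\<^sup>2) (q * x\<^sup>2) k * g (q\<^sup>2) (q\<^sup>2 * z\<^sup>2) l) has_sum
        (jtheta (q\<^sup>2) (q * x\<^sup>2) * jtheta (q\<^sup>2) (q\<^sup>2 * z\<^sup>2))) (UNIV \<times> UNIV)"
      unfolding J by (intro has_sum_times summable q2) (use q x z in auto)
    then have "((\<lambda>p. - (x * z) * (case p of (k, l) \<Rightarrow> g (q\<^sup>2) (q * x\<^sup>2) k * g (q\<^sup>2) (q\<^sup>2 * z\<^sup>2) l)) has_sum
        (- (x / z) * jtheta (q\<^sup>2) (q * x\<^sup>2) * jtheta (q\<^sup>2) (z\<^sup>2))) (UNIV \<times> UNIV)"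
      unfolding s by (rule has_sum_cmult_right)
    also have "?this \<longleftrightarrow> ?thesis"
    \<comment> \<open>Here \<open>m + n = 2 * k + 1\<close> and \<open>m - n = 2 * l + 1\<close>;
      division rounds down, so the inverse map of the even case serves again.\<close>
    proof (rule has_sum_reindex_bij_witness[of _
          "\<lambda>(m, n). ((m + n) div 2, (m - n) div 2)" "\<lambda>(k, l). (k + l + 1, k - l)"])
      fix p :: "int \<times> int"
      obtain k l where p: "p = (k, l)" by (cases p)
      have "(k + l + 1) * (k + l + 1 - 1) + (k - l) * (k - l - 1) = 2 * (k * k + l * l + l)"
        by (simp add: algebra_simps)
      moreover note twice_half_pred[of "k + l + 1"] twice_half_pred[of "k - l"]
      ultimately have e: "(k + l + 1) * (k + l + 1 - 1) div 2 + (k - l) * (k - l - 1) div 2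
          = k * (k - 1) + k + l * (l - 1) + 2 * l"
        by (simp add: algebra_simps)
      have [simp]: "(-1) powi (2 * k + 1) = (-1::real)" "x powi (2 * k + 1) = (x\<^sup>2) powi k * x"
        "z powi (2 * l + 1) = (z\<^sup>2) powi l * z"
        using x z by (simp_all add: power_int_add power_int_mult)
      have "k + l + 1 + (k - l) = 2 * k + 1" "k + l + 1 - (k - l) = 2 * l + 1"
        by auto
      then have "h (k + l + 1, k - l) = - (x * z) * (q powi (k * (k - 1) + k + l * (l - 1) + 2 * l)
          * (x\<^sup>2) powi k * (z\<^sup>2) powi l)"
        unfolding h e by simp
      also have "\<dots> = - (x * z) * (g (q\<^sup>2) (q * x\<^sup>2) k * g (q\<^sup>2) (q\<^sup>2 * z\<^sup>2) l)"
        using q by (simp add: g_def powi_square_half power_int_mult_distrib power_int_add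
            power_int_mult)
      finally show "h (case p of (k, l) \<Rightarrow> (k + l + 1, k - l))
          = - (x * z) * (case p of (k, l) \<Rightarrow> g (q\<^sup>2) (q * x\<^sup>2) k * g (q\<^sup>2) (q\<^sup>2 * z\<^sup>2) l)"
        by (simp add: p)
    qed ((auto; presburger)+)
    finally show ?thesis .
  qed
  have "(h has_sum (jtheta (q\<^sup>2) (x\<^sup>2) * jtheta (q\<^sup>2) (q * z\<^sup>2)
      + - (x / z) * jtheta (q\<^sup>2) (q * x\<^sup>2) * jtheta (q\<^sup>2) (z\<^sup>2)))
      ({(m, n). even (m + n)} \<union> {(m, n). odd (m + n)})"
    by (intro has_sum_Un_disjoint ev od) auto
  also have "{(m, n). even (m + n)} \<union> {(m, n). odd (m + n)} = (UNIV :: (int \<times> int) set)"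
    by auto
  finally show ?thesis
    using has_sum_unique[OF total] by simp
qed

text \<open>By \<open>jtheta_product\<close>, \<open>jtheta q (- (x * z)) * jtheta q (- (x / z)) / x\<close> is a two by two
  determinant in \<open>x\<close> and \<open>z\<close>, so this is a Pluecker relation.\<close>
lemma jtheta_weierstrass:
  assumes q: "0 < q" "q < 1" and nz: "x \<noteq> 0" "y \<noteq> 0" "z \<noteq> 0" "w \<noteq> 0"
  defines "\<theta> \<equiv> \<lambda>u. jtheta q (- u)"
  shows "\<theta> (x * z) * \<theta> (x / z) * (\<theta> (y * w) * \<theta> (y / w))
       - \<theta> (x * w) * \<theta> (x / w) * (\<theta> (y * z) * \<theta> (y / z))
       = x / w * (\<theta> (y * x) * \<theta> (y / x)) * (\<theta> (w * z) * \<theta> (w / z))"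
  unfolding \<theta>_def
    jtheta_product[OF q nz(1) nz(3)] jtheta_product[OF q nz(2) nz(4)]
    jtheta_product[OF q nz(1) nz(4)] jtheta_product[OF q nz(2) nz(3)]
    jtheta_product[OF q nz(2) nz(1)] jtheta_product[OF q nz(4) nz(3)]
  using nz by (simp add: field_simps)

section \<open>The Jacobi triple product\<close>

definition qpoch :: "real \<Rightarrow> real \<Rightarrow> real" where
  "qpoch a q = (\<Prod>k. 1 - a * q ^ k)"

lemma qpoch_convergent:
  fixes a q :: real
  assumes "\<bar>q\<bar> < 1"
  shows "convergent_prod (\<lambda>k. 1 - a * q ^ k)"
proof (rule abs_convergent_prod_imp_convergent_prod)
  have "summable (\<lambda>k. \<bar>a\<bar> * \<bar>q\<bar> ^ k)"
    using assms by (intro summable_mult summable_geometric) auto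
  then show "abs_convergent_prod (\<lambda>k. 1 - a * q ^ k)"
    by (simp add: abs_convergent_prod_conv_summable abs_mult power_abs)
qed

lemma qpoch_LIMSEQ:
  assumes "\<bar>q\<bar> < 1"
  shows "(\<lambda>n. \<Prod>k<n. 1 - a * q ^ k) \<longlonglongrightarrow> qpoch a q"
  using convergent_prod_LIMSEQ[OF qpoch_convergent[OF assms, of a]]
  by (simp add: qpoch_def LIMSEQ_lessThan_iff_atMost)

text \<open>A convergent infinite product vanishes only if one of its factors does; later divisions
  by \<open>qpoch\<close> rest on this.\<close>

lemma qpoch_nonzero:
  assumes "\<bar>q\<bar> < 1" "\<And>k. a * q ^ k \<noteq> 1"
  shows "qpoch a q \<noteq> 0"
proof -
  have "(\<lambda>k. 1 - a * q ^ k) has_prod qpoch a q"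
    unfolding qpoch_def by (rule convergent_prod_has_prod[OF qpoch_convergent[OF assms(1)]])
  then show ?thesis
    using assms(2) has_prod_0D by fastforce
qed

section \<open>The finite form of the triple product\<close>

text \<open>The factors are written \<open>q * q ^ k\<close> so that all three products are
  literally partial products of \<open>qpoch q q\<close>.\<close>

definition gauss_binomial :: "real \<Rightarrow> nat \<Rightarrow> nat \<Rightarrow> real" where
  "gauss_binomial q n i = (\<Prod>k<n. 1 - q * q ^ k) / ((\<Prod>k<i. 1 - q * q ^ k) * (\<Prod>k<n - i. 1 - q * q ^ k))"

lemma qfactorial_bounds:
  assumes "0 < q" "q < 1"
  shows "0 < (\<Prod>k<n. 1 - q * q ^ k)" "(\<Prod>k<n. 1 - q * q ^ k) \<le> (1::real)"
proof -
  have "0 < 1 - q * q ^ k" "1 - q * q ^ k \<le> 1" for k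
    using assms by (auto simp: power_less_one_iff simp flip: power_Suc)
  then show "0 < (\<Prod>k<n. 1 - q * q ^ k)" "(\<Prod>k<n. 1 - q * q ^ k) \<le> 1"
    by (meson prod_pos prod_le_1 less_imp_le)+
qed

lemma gauss_binomial_extremes:
  assumes "0 < q" "q < 1"
  shows "gauss_binomial q n 0 = 1" "gauss_binomial q n n = 1"
  using qfactorial_bounds(1)[OF assms, of n] by (simp_all add: gauss_binomial_def del: prod_zero_iff)

text \<open>The q-Pascal rule: over a common denominator it is \<open>1 - q ^ (n + 1) = (1 - q ^ (n
  - i)) + q ^ (n - i) * (1 - q ^ (i + 1))\<close>. It fails at \<open>i = n\<close>, where truncated
  subtraction makes \<open>gauss_binomial q n (Suc n)\<close> nonzero.\<close>

lemma gauss_binomial_Suc_Suc: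
  assumes q: "0 < q" "q < 1" and "i < n"
  shows "gauss_binomial q (Suc n) (Suc i) = gauss_binomial q n (Suc i) + q ^ (n - i) * gauss_binomial q n i"
proof -
  obtain m where n: "n = i + Suc m"
    using less_imp_Suc_add[OF \<open>i < n\<close>] by auto
  let ?P = "\<lambda>n. \<Prod>k<n. 1 - q * q ^ k"
  have "1 - q * q ^ m > 0" "1 - q * q ^ i > 0"
    using q by (auto simp: power_less_one_iff simp flip: power_Suc)
  moreover have "?P i > 0" "?P m > 0"
    using qfactorial_bounds(1)[OF q] by auto
  ultimately show ?thesis
    unfolding gauss_binomial_def n by (simp add: divide_simps) (simp add: algebra_simps power_add)
qed

text \<open>Rothe's q-binomial theorem, by multiplying with the last factor
  \<open>1 + a * q ^ n\<close> and collecting powers of \<open>a\<close> with the q-Pascal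
  rule.\<close>

lemma q_binomial:
  assumes q: "0 < q" "q < 1"
  shows "(\<Prod>k<n. 1 + a * q ^ k) = (\<Sum>i\<le>n. gauss_binomial q n i * q ^ (i * (i - 1) div 2) * a ^ i)"
proof (induction n)
  case 0
  then show ?case by (simp add: gauss_binomial_extremes[OF q])
next
  case (Suc n)
  define t where "t = (\<lambda>n i. gauss_binomial q n i * q ^ (i * (i - 1) div 2) * a ^ i)"
  have tri: "Suc i * (Suc i - 1) div 2 = i + i * (i - 1) div 2" for i :: nat
    by (cases i) auto
  have step: "t (Suc n) (Suc i) = t n (Suc i) + a * q ^ n * t n i" if "i < n" for i
  proof -
    have "q ^ n = q ^ (n - i) * q ^ i"
      using that by (simp flip: power_add)
    then show ?thesis
      unfolding t_def tri gauss_binomial_Suc_Suc[OF q that] by (simp add: algebra_simps power_add)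
  qed
  \<comment> \<open>The top coefficient is out of reach of the q-Pascal rule and comes only from the
    product with \<open>a * q ^ n\<close>.\<close>
  have last: "t (Suc n) (Suc n) = a * q ^ n * t n n"
    unfolding t_def tri gauss_binomial_extremes[OF q] by (simp add: power_add)
  have "(\<Prod>k<Suc n. 1 + a * q ^ k) = (\<Sum>i\<le>n. t n i) + (\<Sum>i\<le>n. a * q ^ n * t n i)"
    using Suc.IH by (simp add: t_def distrib_left mult.commute[of _ "1 + _"] distrib_right flip: sum_distrib_left)
  also have "(\<Sum>i\<le>n. t n i) = t n 0 + (\<Sum>i<n. t n (Suc i))"
    by (metis lessThan_Suc_atMost sum.lessThan_Suc_shift)
  also have "(\<Sum>i\<le>n. a * q ^ n * t n i) = (\<Sum>i<n. a * q ^ n * t n i) + t (Suc n) (Suc n)"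
    unfolding last by (simp flip: lessThan_Suc_atMost)
  also have "t n 0 + (\<Sum>i<n. t n (Suc i)) + ((\<Sum>i<n. a * q ^ n * t n i) + t (Suc n) (Suc n))
      = t (Suc n) 0 + (\<Sum>i<n. t (Suc n) (Suc i)) + t (Suc n) (Suc n)"
    using step gauss_binomial_extremes[OF q] by (simp add: sum.distrib) (simp add: t_def gauss_binomial_extremes[OF q])
  also have "\<dots> = (\<Sum>i<Suc (Suc n). t (Suc n) i)"
    by (subst sum.lessThan_Suc_shift) simp
  finally show ?case
    by (simp only: lessThan_Suc_atMost t_def)
qed

lemma prod_lessThan_add:
  fixes f :: "nat \<Rightarrow> 'a :: comm_monoid_mult"
  shows "(\<Prod>k<m + n. f k) = (\<Prod>k<m. f k) * (\<Prod>k<n. f (m + k))"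
  by (induction n) (auto simp: mult_ac)

text \<open>With \<open>i = n - k\<close>, each factor is
  \<open>1 - z / q ^ i = - z / q ^ i * (1 - q ^ i / z)\<close>; the prefactors for \<open>i\<close>
  from 1 to \<open>n\<close> multiply to the power of \<open>- z\<close> over a triangular power of
  \<open>q\<close>.\<close>

lemma prod_reversed_factors:
  fixes q z :: real
  assumes "q \<noteq> 0" "z \<noteq> 0"
  shows "(\<Prod>k<n. 1 + - (z / q ^ n) * q ^ k)
    = (- z) ^ n / q ^ (n * (n + 1) div 2) * (\<Prod>k<n. 1 - q / z * q ^ k)"
proof (induction n)
  case (Suc n)
  have "(\<Prod>k<Suc n. 1 + - (z / q ^ Suc n) * q ^ k)
      = (1 - z / q ^ Suc n) * (\<Prod>k<n. 1 + - (z / q ^ n) * q ^ k)"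
    unfolding prod.lessThan_Suc_shift using assms by simp
  also have "1 - z / q ^ Suc n = - z / q ^ Suc n * (1 - q / z * q ^ n)"
    using assms by (simp add: field_simps)
  moreover have "Suc n * (Suc n + 1) div 2 = Suc n + n * (n + 1) div 2"
    by simp
  ultimately show ?case
    using Suc.IH by (simp only: power_add prod.lessThan_Suc) simp
qed simp

text \<open>The q-binomial theorem with \<open>2 * n\<close> factors and
  \<open>a = - (z / q ^ n)\<close>: the first half of the factors gives, up to a constant, those in
  \<open>q / z\<close>, the second half those in \<open>z\<close>. Centring the index at
  \<open>n\<close> makes the sum two-sided.\<close>

lemma finite_jacobi_triple_product:
  fixes q z :: real
  assumes q: "0 < q" "q < 1" and z: "z \<noteq> 0"
  shows "(\<Prod>k<n. 1 - z * q ^ k) * (\<Prod>k<n. 1 - q / z * q ^ k)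
    = (\<Sum>j\<in>{- int n..int n}. gauss_binomial q (2 * n) (nat (int n + j)) * (q powi (j * (j - 1) div 2) * (- z) powi j))"
proof -
  define c where "c = (- z) ^ n / q ^ (n * (n + 1) div 2)"
  have c: "c \<noteq> 0"
    using q z by (simp add: c_def)
  have "c * ((\<Prod>k<n. 1 - z * q ^ k) * (\<Prod>k<n. 1 - q / z * q ^ k)) = (\<Prod>k<n + n. 1 + - (z / q ^ n) * q ^ k)"
    unfolding prod_lessThan_add using prod_reversed_factors[of q z n] q z
    by (simp add: c_def power_add)
  also have "\<dots> = (\<Sum>i\<le>n + n. gauss_binomial q (n + n) i * q ^ (i * (i - 1) div 2) * (- (z / q ^ n)) ^ i)"
    by (rule q_binomial[OF q])
  also have "\<dots> = (\<Sum>j\<in>{- int n..int n}. c * (gauss_binomial q (2 * n) (nat (int n + j)) * (q powi (j * (j - 1) div 2) * (- z) powi j)))"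
  proof (rule sum.reindex_bij_witness[of _ "\<lambda>j. nat (int n + j)" "\<lambda>i. int i - int n"])
    fix i assume "i \<in> {..n + n}"
    define j where "j = int i - int n"
    \<comment> \<open>The exponents mix halves of naturals and of integers, so each half is doubled
      before they are compared. At \<open>i = 0\<close> the truncated \<open>i - 1\<close> is
      multiplied by 0.\<close>
    have "int (i * (i - 1)) = int i * (int i - 1)"
      by (cases i) (auto simp: algebra_simps)
    then have "int (i * (i - 1) div 2) = int i * (int i - 1) div 2"
      by (metis zdiv_int of_nat_numeral)
    then have "2 * int (i * (i - 1) div 2) = int i * (int i - 1)"
      by simp
    moreover have "2 * int (n * (n + 1) div 2) = int n * (int n + 1)"
      by (simp add: zdiv_int algebra_simps)
    moreover have "2 * (j * (j - 1) div 2) = j * (j - 1)"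
      by simp
    moreover have "j * (j - 1) = int i * (int i - 1) + int n * (int n + 1) - 2 * int (n * i)"
      by (simp add: j_def algebra_simps)
    ultimately have e: "j * (j - 1) div 2 = int (i * (i - 1) div 2) + int (n * (n + 1) div 2) - int (n * i)"
      by linarith
    have 1: "q powi (j * (j - 1) div 2) = q ^ (i * (i - 1) div 2) * q ^ (n * (n + 1) div 2) / q ^ (n * i)"
      using q unfolding e by (simp add: power_int_add power_int_diff del: of_nat_mult)
    have 2: "(- z) powi j = (- z) ^ i / (- z) ^ n"
      unfolding j_def using z by (subst power_int_diff) auto
    have 3: "(- (z / q ^ n)) ^ i = (- z) ^ i / q ^ (n * i)"
      by (simp add: power_mult flip: power_divide)
    show "c * (gauss_binomial q (2 * n) (nat (int n + j)) * (q powi (j * (j - 1) div 2) * (- z) powi j))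
        = gauss_binomial q (n + n) i * q ^ (i * (i - 1) div 2) * (- (z / q ^ n)) ^ i"
      unfolding 1 2 3 c_def using q z by (simp add: j_def mult_2)
  qed auto
  finally show ?thesis
    using c by (simp flip: sum_distrib_left)
qed

section \<open>Passage to the limit\<close>

text \<open>Tannery's theorem: a finite set carries \<open>M\<close> up to \<open>e / 3\<close>, so
  every function dominated by \<open>M\<close>, the limit included, has a tail below
  \<open>e / 3\<close>; on the finite set the convergence is uniform.\<close>

lemma infsum_tendsto_dominated:
  fixes f :: "nat \<Rightarrow> 'a \<Rightarrow> real"
  assumes lim: "\<And>j. (\<lambda>n. f n j) \<longlonglongrightarrow> g j"
    and bound: "\<And>n j. \<bar>f n j\<bar> \<le> M j"
    and M: "M summable_on UNIV"
  shows "(\<lambda>n. infsum (f n) UNIV) \<longlonglongrightarrow> infsum g UNIV"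
proof (rule LIMSEQ_I)
  fix e :: real assume "e > 0"
  have bound': "\<bar>g j\<bar> \<le> M j" for j
    by (rule LIMSEQ_le_const2[OF tendsto_rabs[OF lim]]) (use bound in auto)
  have sums: "h summable_on A" if "\<And>j. \<bar>h j\<bar> \<le> M j" for h A
  proof -
    have "(\<lambda>j. norm (h j)) summable_on UNIV"
      by (rule abs_summable_on_comparison_test'[OF M]) (use that in auto)
    from summable_on_subset_banach[OF abs_summable_summable[OF this]] show ?thesis
      by simp
  qed
  obtain X where X: "finite X" "dist (sum M X) (infsum M UNIV) < e / 3"
    using has_sum_infsum[OF M] \<open>e > 0\<close>
    unfolding has_sum_def tendsto_iff eventually_finite_subsets_at_top
    by (elim allE[of _ "e / 3"]) auto
  have tail: "\<bar>infsum h UNIV - sum h X\<bar> < e / 3" if "\<And>j. \<bar>h j\<bar> \<le> M j" for h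
  proof -
    have "infsum h UNIV - sum h X = infsum h (UNIV - X)"
      using sums[OF that] X(1) by (subst infsum_Diff) auto
    also have "\<bar>\<dots>\<bar> \<le> infsum M (UNIV - X)"
      unfolding real_norm_def[symmetric]
    proof (rule norm_infsum_le)
      show "(h has_sum infsum h (UNIV - X)) (UNIV - X)"
        by (rule has_sum_infsum[OF sums[OF that]])
      show "(M has_sum infsum M (UNIV - X)) (UNIV - X)"
        by (intro has_sum_infsum summable_on_subset_banach[OF M]) auto
    qed (use that in auto)
    also have "\<dots> = infsum M UNIV - sum M X"
      using X(1) M by (subst infsum_Diff) auto
    finally show ?thesis
      using X(2) by (simp add: dist_real_def)
  qed
  have "(\<lambda>n. \<Sum>j\<in>X. f n j) \<longlonglongrightarrow> (\<Sum>j\<in>X. g j)"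
    by (intro tendsto_sum lim)
  then obtain N where N: "\<And>n. n \<ge> N \<Longrightarrow> \<bar>(\<Sum>j\<in>X. f n j) - (\<Sum>j\<in>X. g j)\<bar> < e / 3"
    using \<open>e > 0\<close> unfolding LIMSEQ_def dist_real_def by (metis divide_pos_pos zero_less_numeral)
  have "norm (infsum (f n) UNIV - infsum g UNIV) < e" if "n \<ge> N" for n
    using N[OF that] tail[of "f n", OF bound] tail[of g, OF bound'] by (simp add: abs_if split: if_splits)
  then show "\<exists>N. \<forall>n\<ge>N. norm (infsum (f n) UNIV - infsum g UNIV) < e"
    by blast
qed

text \<open>The partial products of \<open>qpoch q q\<close> lie in (0, 1] and decrease to a
  positive limit, which bounds both denominators from below. The upper bound, uniform in
  \<open>n\<close> and \<open>i\<close>, is the domination needed for the triple product.\<close>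

lemma gauss_binomial_bounds:
  assumes q: "0 < q" "q < 1"
  shows "0 \<le> gauss_binomial q n i" "gauss_binomial q n i \<le> 1 / (qpoch q q)\<^sup>2" "0 < qpoch q q"
proof -
  let ?P = "\<lambda>n. \<Prod>k<n. 1 - q * q ^ k"
  note P = qfactorial_bounds[OF q]
  have lim: "?P \<longlonglongrightarrow> qpoch q q"
    using q by (intro qpoch_LIMSEQ) auto
  have "1 - q * q ^ k \<le> 1" for k
    using q by auto
  then have "decseq ?P"
    using P(1) by (intro decseq_SucI) (simp add: mult_left_le less_imp_le)
  then have ge: "qpoch q q \<le> ?P n" for n
    by (rule decseq_ge[OF _ lim])
  have "q * q ^ k \<noteq> 1" for k
    using q power_less_one_iff[of q "Suc k"] by auto
  then have "qpoch q q \<noteq> 0"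
    using q by (intro qpoch_nonzero) auto
  moreover have "qpoch q q \<ge> 0"
    by (rule LIMSEQ_le_const[OF lim]) (use P(1) less_imp_le in blast)
  ultimately show pos: "0 < qpoch q q"
    by simp
  show "0 \<le> gauss_binomial q n i"
    unfolding gauss_binomial_def using P(1) by (simp add: less_imp_le)
  have "(qpoch q q)\<^sup>2 \<le> ?P i * ?P (n - i)"
    unfolding power2_eq_square using ge pos P(1) by (intro mult_mono) (auto intro: less_imp_le)
  then show "gauss_binomial q n i \<le> 1 / (qpoch q q)\<^sup>2"
    unfolding gauss_binomial_def using P pos by (intro frac_le) auto
qed

text \<open>For fixed \<open>j\<close> the indices \<open>2 * n\<close>, \<open>n + j\<close> and
  \<open>n - j\<close> all tend to infinity, so each of the three partial products tends to
  \<open>qpoch q q\<close>.\<close>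

lemma gauss_binomial_central_LIMSEQ:
  assumes q: "0 < q" "q < 1"
  shows "(\<lambda>n. gauss_binomial q (2 * n) (nat (int n + j))) \<longlonglongrightarrow> 1 / qpoch q q"
proof -
  let ?P = "\<lambda>n. \<Prod>k<n. 1 - q * q ^ k"
  have lim: "?P \<longlonglongrightarrow> qpoch q q"
    using q by (intro qpoch_LIMSEQ) auto
  have shift: "filterlim (\<lambda>n. nat (int n + i)) sequentially sequentially" for i
    unfolding filterlim_at_top
  proof
    fix N
    show "\<forall>\<^sub>F n in sequentially. N \<le> nat (int n + i)"
      using eventually_ge_at_top[of "N + nat (- i)"] by eventually_elim linarith
  qed
  have "filterlim (\<lambda>n::nat. 2 * n) sequentially sequentially"
    by (intro filterlim_subseq) (auto simp: strict_mono_def)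
  then have "(\<lambda>n. ?P (2 * n) / (?P (nat (int n + j)) * ?P (nat (int n + - j)))) \<longlonglongrightarrow>
      qpoch q q / (qpoch q q * qpoch q q)"
    using gauss_binomial_bounds(3)[OF q]
    by (intro tendsto_intros filterlim_compose[OF lim] shift) auto
  moreover have "\<forall>\<^sub>F n in sequentially. ?P (2 * n) / (?P (nat (int n + j)) * ?P (nat (int n + - j)))
      = gauss_binomial q (2 * n) (nat (int n + j))"
    using eventually_ge_at_top[of "nat \<bar>j\<bar>"]
  proof eventually_elim
    case (elim n)
    then have "2 * n - nat (int n + j) = nat (int n + - j)"
      by linarith
    then show ?case
      by (simp add: gauss_binomial_def)
  qed
  ultimately have "(\<lambda>n. gauss_binomial q (2 * n) (nat (int n + j))) \<longlonglongrightarrow> qpoch q q / (qpoch q q * qpoch q q)"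
    by (rule Lim_transform_eventually)
  then show ?thesis
    using gauss_binomial_bounds(3)[OF q] by simp
qed

text \<open>The limit of the finite form: every coefficient tends to \<open>1 / qpoch q q\<close>,
  and dominated convergence exchanges limit and sum.\<close>

theorem jacobi_triple_product:
  assumes q: "0 < q" "q < 1" and z: "z \<noteq> 0"
  shows "jtheta q (- z) = qpoch q q * qpoch z q * qpoch (q / z) q"
proof -
  \<comment> \<open>Extension by zero outside the range turns the finite sums into sums over all
    integers.\<close>
  define f where "f = (\<lambda>n j. if j \<in> {- int n..int n} then gauss_binomial q (2 * n) (nat (int n + j))
      * (q powi (j * (j - 1) div 2) * (- z) powi j) else 0)"
  have "(\<lambda>n. infsum (f n) UNIV) \<longlonglongrightarrow>
      (\<Sum>\<^sub>\<infinity>j. 1 / qpoch q q * (q powi (j * (j - 1) div 2) * (- z) powi j))"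
  proof (rule infsum_tendsto_dominated)
    fix j :: int
    have "(\<lambda>n. gauss_binomial q (2 * n) (nat (int n + j)) * (q powi (j * (j - 1) div 2) * (- z) powi j))
        \<longlonglongrightarrow> 1 / qpoch q q * (q powi (j * (j - 1) div 2) * (- z) powi j)"
      by (intro tendsto_intros gauss_binomial_central_LIMSEQ q)
    moreover have "\<forall>\<^sub>F n in sequentially.
        gauss_binomial q (2 * n) (nat (int n + j)) * (q powi (j * (j - 1) div 2) * (- z) powi j) = f n j"
      using eventually_ge_at_top[of "nat \<bar>j\<bar>"] by eventually_elim (auto simp: f_def)
    ultimately show "(\<lambda>n. f n j) \<longlonglongrightarrow> 1 / qpoch q q * (q powi (j * (j - 1) div 2) * (- z) powi j)"
      by (rule Lim_transform_eventually)
    show "\<bar>f n j\<bar> \<le> 1 / (qpoch q q)\<^sup>2 * norm (q powi (j * (j - 1) div 2) * (- z) powi j)" for n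
    proof -
      have "\<bar>gauss_binomial q (2 * n) (nat (int n + j))\<bar> \<le> 1 / (qpoch q q)\<^sup>2"
        using gauss_binomial_bounds(1,2)[OF q, of "2 * n" "nat (int n + j)"] by simp
      from mult_right_mono[OF this, of "norm (q powi (j * (j - 1) div 2) * (- z) powi j)"]
      show ?thesis
        by (auto simp: f_def abs_mult)
    qed
  next
    show "(\<lambda>j. 1 / (qpoch q q)\<^sup>2 * norm (q powi (j * (j - 1) div 2) * (- z) powi j)) summable_on UNIV"
      using summable_theta[OF q, of "- z"] z by (intro summable_on_cmult_right) auto
  qed
  moreover have "infsum (f n) UNIV = (\<Prod>k<n. 1 - z * q ^ k) * (\<Prod>k<n. 1 - q / z * q ^ k)" for n
  proof -
    have "infsum (f n) UNIV = infsum (f n) {- int n..int n}"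
      by (rule infsum_cong_neutral) (auto simp: f_def)
    then show ?thesis
      unfolding finite_jacobi_triple_product[OF q z] by (simp add: f_def)
  qed
  moreover have "(\<lambda>n. (\<Prod>k<n. 1 - z * q ^ k) * (\<Prod>k<n. 1 - q / z * q ^ k)) \<longlonglongrightarrow>
      qpoch z q * qpoch (q / z) q"
    using q by (intro tendsto_intros qpoch_LIMSEQ) auto
  ultimately have "(\<Sum>\<^sub>\<infinity>j. 1 / qpoch q q * (q powi (j * (j - 1) div 2) * (- z) powi j))
      = qpoch z q * qpoch (q / z) q"
    by (simp only: LIMSEQ_unique)
  then have "1 / qpoch q q * jtheta q (- z) = qpoch z q * qpoch (q / z) q"
    by (simp only: jtheta_def infsum_cmult_right')
  then show ?thesis
    using gauss_binomial_bounds(3)[OF q] by (simp add: field_simps)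
qed

text \<open>At the exponents 25, 26, 8, 9 the sums and differences are 33, 17, 35, 17, then 34, 16,
  34, 18, then 51, 1, 17, 1. As \<open>J\<close> is invariant under \<open>a\<close> to
  \<open>68 - a\<close>, only the required residues remain. Each term contains four theta values, so
  the fourth power of \<open>qpoch q q\<close> cancels.\<close>

lemma jtheta_weierstrass_mod_68:
  fixes x :: real
  assumes x: "0 < x" "x < 1"
  defines "J \<equiv> \<lambda>a. qpoch (x ^ a) (x ^ 68) * qpoch (x ^ (68 - a)) (x ^ 68)"
  shows "(J 33)\<^sup>2 * (J 17)\<^sup>2 - x ^ 16 * (J 1)\<^sup>2 * (J 17)\<^sup>2 = J 16 * J 18 * (J 34)\<^sup>2"
proof -
  define q where "q = x ^ 68"
  have q: "0 < q" "q < 1"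
    using x by (auto simp: q_def power_less_one_iff)
  define t where "t = (\<lambda>u. jtheta q (- u))"
  have t: "t (x ^ a) = qpoch q q * J a" if "a \<le> 68" for a
    using x q that unfolding t_def
    by (subst jacobi_triple_product) (auto simp: J_def q_def power_diff)
  have sym: "J 35 = J 33" "J 51 = J 17"
    by (simp_all add: J_def)
  have "t (x ^ 25 * x ^ 8) * t (x ^ 25 / x ^ 8) * (t (x ^ 26 * x ^ 9) * t (x ^ 26 / x ^ 9))
      - t (x ^ 25 * x ^ 9) * t (x ^ 25 / x ^ 9) * (t (x ^ 26 * x ^ 8) * t (x ^ 26 / x ^ 8))
      = x ^ 25 / x ^ 9 * (t (x ^ 26 * x ^ 25) * t (x ^ 26 / x ^ 25)) * (t (x ^ 9 * x ^ 8) * t (x ^ 9 / x ^ 8))"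
    unfolding t_def using x by (intro jtheta_weierstrass q) auto
  moreover have "x ^ 25 * x ^ 8 = x ^ 33" "x ^ 25 / x ^ 8 = x ^ 17" "x ^ 26 * x ^ 9 = x ^ 35"
    "x ^ 26 / x ^ 9 = x ^ 17" "x ^ 25 * x ^ 9 = x ^ 34" "x ^ 25 / x ^ 9 = x ^ 16"
    "x ^ 26 * x ^ 8 = x ^ 34" "x ^ 26 / x ^ 8 = x ^ 18" "x ^ 26 * x ^ 25 = x ^ 51"
    "x ^ 26 / x ^ 25 = x ^ 1" "x ^ 9 * x ^ 8 = x ^ 17" "x ^ 9 / x ^ 8 = x ^ 1"
    using x by (simp_all flip: power_add power_diff)
  moreover have "t (x ^ 33) = qpoch q q * J 33" "t (x ^ 17) = qpoch q q * J 17"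
    "t (x ^ 35) = qpoch q q * J 35" "t (x ^ 34) = qpoch q q * J 34"
    "t (x ^ 16) = qpoch q q * J 16" "t (x ^ 18) = qpoch q q * J 18"
    "t (x ^ 51) = qpoch q q * J 51" "t (x ^ 1) = qpoch q q * J 1"
    by (rule t; simp)+
  ultimately have "(qpoch q q) ^ 4 * (J 33 * J 17 * (J 35 * J 17) - J 34 * J 16 * (J 34 * J 18))
      = (qpoch q q) ^ 4 * (x ^ 16 * (J 51 * J 1) * (J 17 * J 1))"
    by (simp only: algebra_simps power4_eq_xxxx)
  then have "J 33 * J 17 * (J 35 * J 17) - J 34 * J 16 * (J 34 * J 18) = x ^ 16 * (J 51 * J 1) * (J 17 * J 1)"
    using gauss_binomial_bounds(3)[OF q] by simp
  then show ?thesis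
    unfolding sym by (simp add: power2_eq_square algebra_simps)
qed

section \<open>Generating functions of coloured partitions\<close>

lemma shifted_power_series_sums:
  fixes b :: "nat \<Rightarrow> real"
  assumes "(\<lambda>n. b n * x ^ n) sums t"
  shows "(\<lambda>n. (if m \<le> n then b (n - m) else 0) * x ^ n) sums (x ^ m * t)"
proof -
  have "(\<lambda>n. x ^ m * (b n * x ^ n)) sums (x ^ m * t)"
    by (intro sums_mult assms)
  also have "(\<lambda>n. x ^ m * (b n * x ^ n)) = (\<lambda>n. (if m \<le> n + m then b (n + m - m) else 0) * x ^ (n + m))"
    by (simp add: power_add mult_ac)
  finally show ?thesis
    by (subst (asm) sums_zero_iff_shift) auto
qed

text \<open>The recurrence says \<open>B = s + x ^ m * B\<close> for the sum \<open>B\<close> of the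
  \<open>b\<close>-series. Its convergence is not presupposed: nonnegativity and the recurrence
  bound the partial sums.\<close>

lemma sums_geometric_recurrence:
  fixes a b :: "nat \<Rightarrow> real"
  assumes x: "0 < x" "x < 1" and m: "0 < m"
    and nonneg: "\<And>n. a n \<ge> 0" "\<And>n. b n \<ge> 0"
    and rec: "\<And>n. b n = a n + (if m \<le> n then b (n - m) else 0)"
    and a: "(\<lambda>n. a n * x ^ n) sums s"
  shows "(\<lambda>n. b n * x ^ n) sums (s / (1 - x ^ m))"
proof -
  have xm: "x ^ m < 1"
    using x m by (simp add: power_less_one_iff)
  have "(\<Sum>n<N. b n * x ^ n) \<le> s / (1 - x ^ m)" for N
  proof -
    let ?B = "\<Sum>n<N. b n * x ^ n"
    have "?B = (\<Sum>n<N. a n * x ^ n) + (\<Sum>n<N. (if m \<le> n then b (n - m) else 0) * x ^ n)"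
      by (subst rec) (simp add: algebra_simps sum.distrib)
    moreover have "(\<Sum>n<N. a n * x ^ n) \<le> s"
      using sum_le_suminf[OF sums_summable[OF a], of "{..<N}"] sums_unique[OF a] nonneg x by auto
    \<comment> \<open>The shifted partial sum is \<open>x ^ m\<close> times a shorter partial sum;
      completing it only adds nonnegative terms.\<close>
    moreover have "(\<Sum>n<N. (if m \<le> n then b (n - m) else 0) * x ^ n) \<le> x ^ m * ?B"
    proof -
      have "(\<Sum>n<N. (if m \<le> n then b (n - m) else 0) * x ^ n) = (\<Sum>n\<in>{m..<N}. b (n - m) * x ^ n)"
        by (rule sum.mono_neutral_cong_right) auto
      also have "\<dots> = (\<Sum>k<N - m. x ^ m * (b k * x ^ k))"
        by (rule sum.reindex_bij_witness[of _ "\<lambda>k. k + m" "\<lambda>n. n - m"])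
          (auto simp flip: power_add)
      also have "\<dots> \<le> (\<Sum>k<N. x ^ m * (b k * x ^ k))"
        using nonneg x by (intro sum_mono2) auto
      finally show ?thesis
        by (simp add: sum_distrib_left)
    qed
    ultimately have "?B * (1 - x ^ m) \<le> s"
      by (simp add: algebra_simps)
    then show ?thesis
      using xm by (simp add: field_simps)
  qed
  then have "summable (\<lambda>n. b n * x ^ n)"
    using nonneg x by (intro summableI_nonneg_bounded) auto
  then obtain t where t: "(\<lambda>n. b n * x ^ n) sums t"
    by (auto simp: summable_def)
  have "(\<lambda>n. a n * x ^ n + (if m \<le> n then b (n - m) else 0) * x ^ n) sums (s + x ^ m * t)"
    by (intro sums_add a shifted_power_series_sums t)
  also have "(\<lambda>n. a n * x ^ n + (if m \<le> n then b (n - m) else 0) * x ^ n) = (\<lambda>n. b n * x ^ n)"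
    by (subst (2) rec) (auto simp: algebra_simps)
  finally have "t = s + x ^ m * t"
    by (rule sums_unique2[OF t])
  then have "t = s / (1 - x ^ m)"
    using xm by (simp add: field_simps)
  with t show ?thesis
    by simp
qed

text \<open>Restricting to a set \<open>A\<close> of coloured parts allows \<open>A\<close> to be
  finite and to grow by one coloured part at a time.\<close>

definition partitions_into :: "(nat \<times> nat) set \<Rightarrow> nat \<Rightarrow> (nat \<times> nat) multiset set" where
  "partitions_into A n = {M. set_mset M \<subseteq> A \<and> (\<Sum>p\<in>#M. fst p) = n}"

lemma partitions_into_subset:
  assumes "A \<subseteq> {(m, c). 0 < m \<and> c < r m}"
  shows "partitions_into A n \<subseteq> colored_partitions r n"
  using assms by (fastforce simp: partitions_into_def colored_partitions_def)

text \<open>Either \<open>p\<close> does not occur, or one copy of it can be removed; the remainder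
  may contain \<open>p\<close> again.\<close>

lemma partitions_into_insert:
  "partitions_into (insert p A) n = partitions_into A n \<union>
     (if fst p \<le> n then add_mset p ` partitions_into (insert p A) (n - fst p) else {})"
  (is "?L = ?R")
proof (intro equalityI subsetI)
  fix M assume "M \<in> ?L"
  then have M: "set_mset M \<subseteq> insert p A" "(\<Sum>p\<in>#M. fst p) = n"
    unfolding partitions_into_def by blast+
  show "M \<in> ?R"
  proof (cases "p \<in># M")
    case True
    obtain M' where M': "M = add_mset p M'"
      using multi_member_split[OF True] by blast
    have "set_mset M' \<subseteq> insert p A" "fst p + (\<Sum>p\<in>#M'. fst p) = n"
      using M unfolding M' by simp_all
    then have "M' \<in> partitions_into (insert p A) (n - fst p)" "fst p \<le> n"
      unfolding partitions_into_def by force+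
    then show ?thesis
      unfolding M' by simp
  next
    case False
    with M have "M \<in> partitions_into A n"
      unfolding partitions_into_def by blast
    then show ?thesis ..
  qed
next
  fix M assume "M \<in> ?R"
  then consider "M \<in> partitions_into A n"
    | M' where "fst p \<le> n" "M = add_mset p M'" "M' \<in> partitions_into (insert p A) (n - fst p)"
    by (cases "fst p \<le> n") (simp_all, blast)
  then show "M \<in> ?L"
  proof cases
    case 1
    then show ?thesis
      unfolding partitions_into_def by blast
  next
    case 2
    then have "set_mset M' \<subseteq> insert p A" "(\<Sum>p\<in>#M'. fst p) = n - fst p"
      unfolding partitions_into_def by blast+
    with 2 show ?thesis
      by (simp add: partitions_into_def)
  qed
qed

text \<open>Each new coloured part contributes one geometric factor, through the recurrence that
  separates partitions with and without it.\<close>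

lemma partitions_into_sums:
  assumes x: "0 < x" "x < 1"
    and "finite A" "A \<subseteq> {(m, c). 0 < m \<and> c < r m}"
  shows "(\<lambda>n. real (card (partitions_into A n)) * x ^ n) sums (\<Prod>p\<in>A. 1 / (1 - x ^ fst p))"
  using assms(3,4)
proof (induction A rule: finite_induct)
  case empty
  have "partitions_into {} n = (if n = 0 then {{#}} else {})" for n
    by (auto simp: partitions_into_def)
  then have "real (card (partitions_into {} n)) * x ^ n = (if n = 0 then 1 else 0)" for n
    by simp
  then show ?case
    using sums_single[of 0 "\<lambda>_. 1 :: real"] by simp
next
  case (insert p A)
  \<comment> \<open>Adding cardinalities requires finite sets; finiteness is inherited from
    \<open>colored_partitions r n\<close>.\<close>
  have fin: "finite (partitions_into B n)" if "B \<subseteq> insert p A" for B n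
    using partitions_into_subset[of B r n] that insert.prems finite_colored_partitions
    by (meson finite_subset order_trans)
  have p: "0 < fst p"
    using insert.prems by auto
  have rec: "real (card (partitions_into (insert p A) n)) = real (card (partitions_into A n))
      + (if fst p \<le> n then real (card (partitions_into (insert p A) (n - fst p))) else 0)" for n
  proof (cases "fst p \<le> n")
    case True
    have "p \<notin># M" if "M \<in> partitions_into A n" for M
      using that insert.hyps(2) unfolding partitions_into_def by blast
    then have disj: "partitions_into A n \<inter> add_mset p ` partitions_into (insert p A) (n - fst p) = {}"
      by force
    have "partitions_into (insert p A) n
        = partitions_into A n \<union> add_mset p ` partitions_into (insert p A) (n - fst p)"
      by (subst partitions_into_insert) (simp add: True)
    then have "card (partitions_into (insert p A) n) = card (partitions_into A n)
        + card (add_mset p ` partitions_into (insert p A) (n - fst p))"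
      using card_Un_disjoint[OF fin finite_imageI[OF fin] disj] by auto
    also have "card (add_mset p ` partitions_into (insert p A) (n - fst p))
        = card (partitions_into (insert p A) (n - fst p))"
      by (intro card_image) (auto simp: inj_on_def)
    finally show ?thesis
      using True by simp
  next
    case False
    then show ?thesis
      by (subst partitions_into_insert) simp
  qed
  have sub: "A \<subseteq> {(m, c). 0 < m \<and> c < r m}"
    using insert.prems by auto
  have eq: "(\<Prod>p\<in>insert p A. 1 / (1 - x ^ fst p)) = (\<Prod>p\<in>A. 1 / (1 - x ^ fst p)) / (1 - x ^ fst p)"
    using insert.hyps by simp
  show ?case
    unfolding eq
    by (rule sums_geometric_recurrence[where a = "\<lambda>n. real (card (partitions_into A n))"
          and b = "\<lambda>n. real (card (partitions_into (insert p A) n))",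
          OF x p of_nat_0_le_iff of_nat_0_le_iff rec insert.IH[OF sub]])
qed

text \<open>The partial sums are squeezed: those of the full series are at most the finite product, whose
  own series is termwise dominated by the full one.\<close>
lemma colored_partitions_sums:
  assumes x: "0 < x" "x < 1" and r: "r 0 = 0" and d: "0 < d"
    and lim: "(\<lambda>N. \<Prod>m<N * d. (1 / (1 - x ^ m)) ^ r m) \<longlonglongrightarrow> L"
  shows "(\<lambda>n. real (card (colored_partitions r n)) * x ^ n) sums L"
proof -
  let ?c = "\<lambda>n. real (card (colored_partitions r n)) * x ^ n"
  define A where "A = (\<lambda>N. SIGMA m:{..<N}. {..<r m})"
  \<comment> \<open>The factor at \<open>m = 0\<close> is \<open>1 / 0 = 0\<close> raised to the
    power \<open>r 0 = 0\<close>, hence 1.\<close>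
  define P where "P = (\<lambda>N. \<Prod>m<N. (1 / (1 - x ^ m)) ^ r m)"
  have A: "finite (A N)" "A N \<subseteq> {(m, c). 0 < m \<and> c < r m}" for N
    using r by (auto simp: A_def intro!: Nat.gr0I)
  have "P N = (\<Prod>p\<in>A N. 1 / (1 - x ^ fst p))" for N
    using prod.Sigma[of "{..<N}" "\<lambda>m. {..<r m}" "\<lambda>m c. 1 / (1 - x ^ m)"]
    by (simp add: P_def A_def case_prod_beta)
  then have sums: "(\<lambda>n. real (card (partitions_into (A N) n)) * x ^ n) sums P N" for N
    using partitions_into_sums[OF x A(1) A(2), of N] by simp
  have le: "card (partitions_into (A N) n) \<le> card (colored_partitions r n)" for N n
    by (intro card_mono finite_colored_partitions partitions_into_subset A)
  \<comment> \<open>No part of a partition of \<open>n\<close> exceeds \<open>n\<close>, so a size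
    bound \<open>N\<close> above \<open>n\<close> excludes nothing.\<close>
  have eq: "partitions_into (A N) n = colored_partitions r n" if "n < N" for N n
  proof
    show "colored_partitions r n \<subseteq> partitions_into (A N) n"
    proof
      fix M assume M: "M \<in> colored_partitions r n"
      have "p \<in> A N" if "p \<in># M" for p
      proof -
        obtain M' where "M = add_mset p M'"
          using multi_member_split[OF \<open>p \<in># M\<close>] by blast
        with M have "fst p \<le> n" "snd p < r (fst p)"
          by (auto simp: colored_partitions_def)
        with \<open>n < N\<close> show ?thesis
          by (simp add: A_def mem_Times_iff mem_Sigma_iff[of "fst p" "snd p", simplified])
      qed
      with M show "M \<in> partitions_into (A N) n"
        by (auto simp: colored_partitions_def partitions_into_def)
    qed
  qed (intro partitions_into_subset A)
  have lower: "(\<Sum>n<N. ?c n) \<le> P N" for N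
  proof -
    have "(\<Sum>n<N. ?c n) = (\<Sum>n<N. real (card (partitions_into (A N) n)) * x ^ n)"
      by (intro sum.cong) (auto simp: eq)
    also have "\<dots> \<le> P N"
      unfolding sums_unique[OF sums] using x
      by (intro sum_le_suminf sums_summable[OF sums]) auto
    finally show ?thesis .
  qed
  have lim: "(\<lambda>N. P (N * d)) \<longlonglongrightarrow> L"
    using assms(5) unfolding P_def .
  then have "Bseq (\<lambda>N. P (N * d))"
    by (intro convergent_imp_Bseq convergentI)
  then obtain K where "\<bar>P (N * d)\<bar> \<le> K" for N
    unfolding Bseq_def by auto
  then have K: "P (N * d) \<le> K" for N
    by (rule order_trans[OF abs_ge_self])
  have "(\<Sum>n<N. ?c n) \<le> K" for N
  proof -
    \<comment> \<open>The products are controlled only along multiples of \<open>d\<close>; monotone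
      partial sums carry the bound over to all \<open>N\<close>.\<close>
    have "(\<Sum>n<N. ?c n) \<le> (\<Sum>n<N * d. ?c n)"
      using x d by (intro sum_mono2) (auto intro: less_le_trans)
    also have "\<dots> \<le> K"
      using lower K order_trans by blast
    finally show ?thesis .
  qed
  then have summable: "summable ?c"
    using x by (intro summableI_nonneg_bounded) auto
  have "(\<lambda>N. P (N * d)) \<longlonglongrightarrow> suminf ?c"
  proof (rule tendsto_sandwich)
    have "filterlim (\<lambda>N. N * d) sequentially sequentially"
      using d by (intro filterlim_subseq) (auto simp: strict_mono_def)
    from filterlim_compose[OF summable_LIMSEQ[OF summable] this]
    show "(\<lambda>N. \<Sum>n<N * d. ?c n) \<longlonglongrightarrow> suminf ?c" .
    show "\<forall>\<^sub>F N in sequentially. P (N * d) \<le> suminf ?c"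
      unfolding sums_unique[OF sums] using le x
      by (intro always_eventually allI suminf_le mult_right_mono summable sums_summable[OF sums]) auto
  qed (use lower in auto)
  then have "L = suminf ?c"
    by (rule LIMSEQ_unique[OF lim])
  then show ?thesis
    using summable_sums[OF summable] by (rule ssubst)
qed

text \<open>Writing \<open>m = k * d + s\<close> splits the product over \<open>m < N * d\<close>
  into \<open>N\<close> full periods; exchanging the products leaves, for each residue
  \<open>s\<close>, a partial product of \<open>qpoch (x ^ s) (x ^ d)\<close>.\<close>

lemma colored_partitions_periodic_sums:
  fixes \<rho> :: "nat \<Rightarrow> nat"
  assumes x: "0 < x" "x < 1" and \<rho>: "\<rho> 0 = 0" and d: "0 < d"
  shows "(\<lambda>n. real (card (colored_partitions (\<lambda>m. \<rho> (m mod d)) n)) * x ^ n) sums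
    (\<Prod>s<d. 1 / qpoch (x ^ s) (x ^ d) ^ \<rho> s)"
proof (rule colored_partitions_sums[OF x _ d])
  have xd: "\<bar>x ^ d\<bar> < 1"
    using x d by (simp add: power_abs power_less_one_iff)
  have "(\<lambda>N. \<Prod>s<d. 1 / (\<Prod>k<N. 1 - x ^ s * (x ^ d) ^ k) ^ \<rho> s) \<longlonglongrightarrow> (\<Prod>s<d. 1 / qpoch (x ^ s) (x ^ d) ^ \<rho> s)"
  proof (rule tendsto_prod)
    fix s
    show "(\<lambda>N. 1 / (\<Prod>k<N. 1 - x ^ s * (x ^ d) ^ k) ^ \<rho> s) \<longlonglongrightarrow> 1 / qpoch (x ^ s) (x ^ d) ^ \<rho> s"
    \<comment> \<open>At \<open>s = 0\<close> the product has the factor 0, but its exponent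
      \<open>\<rho> 0 = 0\<close> makes both sides 1.\<close>
    proof (cases "s = 0")
      case False
      then have "x ^ s * (x ^ d) ^ k \<noteq> 1" for k
        using x power_less_one_iff[of x "s + d * k"] by (simp flip: power_add power_mult)
      then have "qpoch (x ^ s) (x ^ d) \<noteq> 0"
        by (intro qpoch_nonzero xd)
      then show ?thesis
        by (intro tendsto_intros qpoch_LIMSEQ xd) auto
    qed (simp add: \<rho>)
  qed
  moreover have "(\<Prod>m<N * d. (1 / (1 - x ^ m)) ^ \<rho> (m mod d))
      = (\<Prod>s<d. 1 / (\<Prod>k<N. 1 - x ^ s * (x ^ d) ^ k) ^ \<rho> s)" for N
  proof -
    have "(\<Prod>m<N * d. (1 / (1 - x ^ m)) ^ \<rho> (m mod d))
        = (\<Prod>k<N. \<Prod>m\<in>{k * d..<k * d + d}. (1 / (1 - x ^ m)) ^ \<rho> (m mod d))"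
      by (rule prod.nat_group[symmetric])
    also have "\<dots> = (\<Prod>k<N. \<Prod>s<d. (1 / (1 - x ^ s * (x ^ d) ^ k)) ^ \<rho> s)"
    proof (rule prod.cong[OF refl])
      fix k
      show "(\<Prod>m\<in>{k * d..<k * d + d}. (1 / (1 - x ^ m)) ^ \<rho> (m mod d))
          = (\<Prod>s<d. (1 / (1 - x ^ s * (x ^ d) ^ k)) ^ \<rho> s)"
      proof (rule prod.reindex_bij_witness[of _ "\<lambda>s. k * d + s" "\<lambda>m. m - k * d"])
        fix m assume "m \<in> {k * d..<k * d + d}"
        then obtain s where s: "m = k * d + s" "s < d"
          by (auto simp: le_iff_add)
        then show "(1 / (1 - x ^ (m - k * d) * (x ^ d) ^ k)) ^ \<rho> (m - k * d) = (1 / (1 - x ^ m)) ^ \<rho> (m mod d)"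
          by (simp add: power_add power_mult[symmetric] mult_ac)
      qed auto
    qed
    also have "\<dots> = (\<Prod>s<d. \<Prod>k<N. (1 / (1 - x ^ s * (x ^ d) ^ k)) ^ \<rho> s)"
      by (rule prod.swap)
    finally show ?thesis
      by (simp add: prod_dividef prod_power_distrib power_divide)
  qed
  ultimately show "(\<lambda>N. \<Prod>m<N * d. (1 / (1 - x ^ m)) ^ \<rho> (m mod d))
      \<longlonglongrightarrow> (\<Prod>s<d. 1 / qpoch (x ^ s) (x ^ d) ^ \<rho> s)"
    by simp
qed (simp add: \<rho>)

section \<open>Comparison of coefficients\<close>

text \<open>Once the lower coefficients vanish, division by \<open>x ^ n\<close> leaves a series
  that is zero on (0, 1) and continuous at 0, where its value is \<open>a n\<close>.\<close>

lemma power_series_coeffs_zero: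
  fixes a :: "nat \<Rightarrow> real"
  assumes "\<And>x. 0 < x \<Longrightarrow> x < 1 \<Longrightarrow> (\<lambda>n. a n * x ^ n) sums 0"
  shows "a n = 0"
proof (induction n rule: less_induct)
  case (less n)
  let ?f = "\<lambda>x. \<Sum>k. a (k + n) * x ^ k"
  have sums: "(\<lambda>k. a (k + n) * x ^ k) sums 0" if x: "0 < x" "x < 1" for x
  proof -
    have "(\<lambda>k. a (k + n) * x ^ (k + n)) sums 0"
      using assms[OF x] less.IH by (subst sums_zero_iff_shift) auto
    then have "(\<lambda>k. a (k + n) * x ^ (k + n) / x ^ n) sums (0 / x ^ n)"
      by (rule sums_divide)
    then show ?thesis
      using x by (simp add: power_add)
  qed
  have "isCont ?f 0"
    using sums_summable[OF sums[of "1/2"]] by (intro isCont_powser[where K = "1/2"]) auto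
  \<comment> \<open>The sums are known only for positive \<open>x\<close>, hence the one-sided
    limit.\<close>
  then have "(?f \<longlongrightarrow> ?f 0) (at_right 0)"
    unfolding isCont_def by (rule filterlim_mono[OF _ order_refl at_le]) auto
  moreover have "\<forall>\<^sub>F x in at_right (0::real). ?f x = 0"
    unfolding eventually_at_right[OF zero_less_one] using sums_unique[OF sums] by force
  then have "(?f \<longlongrightarrow> 0) (at_right 0)"
    by (simp add: tendsto_eventually)
  ultimately have "?f 0 = 0"
    by (rule tendsto_unique[OF trivial_limit_at_right_real])
  then show ?case
    by simp
qed

theorem theorem4p1:
  fixes n :: nat
  assumes "n \<ge> 16"
  shows "int (D1 n) - int (D2 (n - 16)) - int (D3 n) = 0"
proof -
  \<comment> \<open>Below 16 the middle term must be 0, whereas truncated subtraction would give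
    \<open>D2 0 = 1\<close>. The comparison of series yields \<open>a n = 0\<close> for all
    \<open>n\<close>.\<close>
  define a where "a = (\<lambda>n. real (D1 n) - (if 16 \<le> n then real (D2 (n - 16)) else 0) - real (D3 n))"
  have "a n = 0" for n
  proof (rule power_series_coeffs_zero)
    fix x :: real assume x: "0 < x" "x < 1"
    define Q where "Q = (\<lambda>k. qpoch (x ^ k) (x ^ 68))"
    have x68: "\<bar>x ^ 68\<bar> < 1"
      using x by (simp add: power_less_one_iff)
    have Q: "Q k \<noteq> 0" if "0 < k" for k
      unfolding Q_def
    proof (rule qpoch_nonzero[OF x68])
      show "x ^ k * (x ^ 68) ^ i \<noteq> 1" for i
        using x that power_less_one_iff[of x "k + 68 * i"] by (simp flip: power_add power_mult)
    qed
    \<comment> \<open>\<open>S\<close> is a set of residues containing the support of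
      \<open>\<rho>\<close>, so that the product over all 68 residues reduces to a few explicit
      factors.\<close>
    have gf: "(\<lambda>n. real (card (colored_partitions (\<lambda>m. \<rho> (m mod 68)) n)) * x ^ n) sums (\<Prod>s\<in>S. 1 / Q s ^ \<rho> s)"
      if "\<rho> 0 = 0" "S \<subseteq> {..<68}" "\<And>s. s \<in> {..<68} - S \<Longrightarrow> \<rho> s = 0" for \<rho> :: "nat \<Rightarrow> nat" and S
    proof -
      have "(\<Prod>s<68. 1 / Q s ^ \<rho> s) = (\<Prod>s\<in>S. 1 / Q s ^ \<rho> s)"
        using that by (intro prod.mono_neutral_right) auto
      with colored_partitions_periodic_sums[where \<rho> = \<rho> and d = 68, OF x that(1)] show ?thesis
        by (simp add: Q_def)
    qed
    define J where "J = (\<lambda>k. Q k * Q (68 - k))"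
    have J: "J k \<noteq> 0" if "0 < k" "k < 68" for k
      using that by (simp add: J_def Q)
    \<comment> \<open>Opposite residues pair up to \<open>J\<close>. As \<open>J 34\<close> is the
      square of \<open>Q 34\<close>, the four colours of the residue 34 give
      \<open>(J 34)\<^sup>2\<close>.\<close>
    have D1: "(\<lambda>n. real (D1 n) * x ^ n) sums (1 / (J 16 * J 18 * (J 1)\<^sup>2 * (J 34)\<^sup>2))"
      using gf[of "\<lambda>s. if s \<in> {1, 67} then 2 else if s = 34 then 4 else if s \<in> {16, 18, 50, 52} then 1 else 0"
          "{1, 16, 18, 34, 50, 52, 67}"]
      by (simp add: D1_def J_def power2_eq_square power4_eq_xxxx mult_ac)
    have D2: "(\<lambda>n. real (D2 n) * x ^ n) sums (1 / (J 16 * J 18 * (J 33)\<^sup>2 * (J 34)\<^sup>2))"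
      using gf[of "\<lambda>s. if s \<in> {33, 35} then 2 else if s = 34 then 4 else if s \<in> {16, 18, 50, 52} then 1 else 0"
          "{16, 18, 33, 34, 35, 50, 52}"]
      by (simp add: D2_def J_def power2_eq_square power4_eq_xxxx mult_ac)
    have D3: "(\<lambda>n. real (D3 n) * x ^ n) sums (1 / ((J 1)\<^sup>2 * (J 17)\<^sup>2 * (J 33)\<^sup>2))"
      using gf[of "\<lambda>s. if s \<in> {1, 17, 33, 35, 51, 67} then 2 else 0" "{1, 17, 33, 35, 51, 67}"]
      by (simp add: D3_def J_def power2_eq_square mult_ac)
    have "(\<lambda>n. a n * x ^ n) sums (1 / (J 16 * J 18 * (J 1)\<^sup>2 * (J 34)\<^sup>2)
        - x ^ 16 * (1 / (J 16 * J 18 * (J 33)\<^sup>2 * (J 34)\<^sup>2)) - 1 / ((J 1)\<^sup>2 * (J 17)\<^sup>2 * (J 33)\<^sup>2))"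
      unfolding a_def left_diff_distrib
      by (intro sums_diff D1 D3 shifted_power_series_sums D2)
    \<comment> \<open>Over the common denominator the numerator is the left side of the theta
      identity; its right side cancels exactly what distinguishes this fraction from the series of
      \<open>D3\<close>.\<close>
    also have "1 / (J 16 * J 18 * (J 1)\<^sup>2 * (J 34)\<^sup>2) - x ^ 16 * (1 / (J 16 * J 18 * (J 33)\<^sup>2 * (J 34)\<^sup>2))
        = ((J 33)\<^sup>2 * (J 17)\<^sup>2 - x ^ 16 * (J 1)\<^sup>2 * (J 17)\<^sup>2)
          / (J 16 * J 18 * (J 34)\<^sup>2 * ((J 1)\<^sup>2 * (J 17)\<^sup>2 * (J 33)\<^sup>2))"
      by (simp add: J field_simps)
    also have "(J 33)\<^sup>2 * (J 17)\<^sup>2 - x ^ 16 * (J 1)\<^sup>2 * (J 17)\<^sup>2 = J 16 * J 18 * (J 34)\<^sup>2"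
      using jtheta_weierstrass_mod_68[OF x] by (simp only: J_def Q_def)
    finally show "(\<lambda>n. a n * x ^ n) sums 0"
      by (simp add: J)
  qed
  from this[of n] have "real (D1 n) - real (D2 (n - 16)) - real (D3 n) = 0"
    using assms by (simp add: a_def)
  then show ?thesis
    by linarith
qed

end
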